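(* Let $d\ge2$, $\Lambda$ a full rank lattice in $\mathbb{R}^d$ of covolume $1$, $\Lambda^\ast$ its dual lattice, and $f(\boldsymbol\tau)=|\boldsymbol\tau|_+$. Then \[ \underline{\psi}_1(\Lambda,f)\le\frac{\underline{\psi}_1(\Lambda^\ast,f)}{(d-1)^2}. \]
   Context: $\mathcal T=\{\boldsymbol\tau\in\mathbb{R}^d:\sum\tau_i=0\}$, $|\boldsymbol\tau|_+=\max_i\tau_i$, $|\cdot|$ the supremum norm. $\mathcal B$ is the unit ball of the supremum norm, $\mathcal B_{\boldsymbol\tau}=\mathrm{diag}(e^{\tau_1},\dots,e^{\tau_d})\mathcal B$, $L_k(M,\boldsymbol\tau)=\log\lambda_k(\mathcal B_{\boldsymbol\tau},M)$ with $\lambda_k$ the $k$-th successive minimum of the lattice $M$. $\underline{\psi}_k(M,f)=\liminf_{|\boldsymbol\tau|\to\infty,\ \boldsymbol\tau\in\mathcal T}L_k(M,\boldsymbol\tau)/f(\boldsymbol\tau)$. *)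

theory Defs
  imports "HOL-Analysis.Analysis"
begin

text \<open>The dimension \<open>d\<close> is \<open>CARD('n)\<close>. A lattice basis is given as the columns of a matrix.\<close>

definition lattice_basis :: "real^'n^'n \<Rightarrow> (real^'n) set \<Rightarrow> bool" where
  "lattice_basis A M \<longleftrightarrow> invertible A \<and> M = (\<lambda>z. A *v z) ` {z. \<forall>i. z $ i \<in> \<int>}"

definition full_rank_lattice :: "(real^'n) set \<Rightarrow> bool" where
  "full_rank_lattice M \<longleftrightarrow> (\<exists>A. lattice_basis A M)"

definition covolume :: "(real^'n) set \<Rightarrow> real" where
  "covolume M = (THE c. \<exists>A. lattice_basis A M \<and> c = \<bar>det A\<bar>)"

definition dual_lattice :: "(real^'n) set \<Rightarrow> (real^'n) set" where
  "dual_lattice M = {y. \<forall>x\<in>M. x \<bullet> y \<in> \<int>}"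

definition successive_minimum :: "nat \<Rightarrow> (real^'n) set \<Rightarrow> (real^'n) set \<Rightarrow> real" where
  "successive_minimum k C M =
     Inf {l. l > 0 \<and> (\<exists>S. S \<subseteq> M \<inter> (\<lambda>x. l *\<^sub>R x) ` C \<and> independent S \<and> card S = k)}"

definition trace_zero :: "(real^'n) set" where
  "trace_zero = {\<tau>. (\<Sum>i\<in>UNIV. \<tau> $ i) = 0}"

definition plus_norm :: "real^'n \<Rightarrow> real" where
  "plus_norm \<tau> = Max (range (\<lambda>i. \<tau> $ i))"

definition sup_ball :: "(real^'n) set" where
  "sup_ball = {x. infnorm x \<le> 1}"

definition diag_exp :: "real^'n \<Rightarrow> real^'n^'n" where
  "diag_exp \<tau> = (\<chi> i j. if i = j then exp (\<tau> $ i) else 0)"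

definition scaled_ball :: "real^'n \<Rightarrow> (real^'n) set" where
  "scaled_ball \<tau> = (\<lambda>x. diag_exp \<tau> *v x) ` sup_ball"

definition L :: "nat \<Rightarrow> (real^'n) set \<Rightarrow> real^'n \<Rightarrow> real" where
  "L k M \<tau> = ln (successive_minimum k (scaled_ball \<tau>) M)"

definition psi_lower :: "nat \<Rightarrow> (real^'n) set \<Rightarrow> (real^'n \<Rightarrow> real) \<Rightarrow> ereal" where
  "psi_lower k M f =
     Liminf (inf (filtercomap infnorm at_top) (principal trace_zero)) (\<lambda>\<tau>. ereal (L k M \<tau> / f \<tau>))"

text \<open>The covolume does not depend on the choice of the basis.\<close>

lemma lattice_basis_change:
  fixes A B :: "real^'n^'n"
  assumes "lattice_basis A M" "lattice_basis B M"
  obtains U where "A = B ** U" "det U \<in> \<int>"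
proof -
  have "\<exists>u. (\<forall>i. u $ i \<in> \<int>) \<and> A *v axis j 1 = B *v u" for j
  proof -
    have "\<forall>i. (axis j 1 :: real^'n) $ i \<in> \<int>"
      by (simp add: axis_def)
    then have "A *v axis j 1 \<in> M"
      using assms(1) by (auto simp: lattice_basis_def)
    then show ?thesis
      using assms(2) by (auto simp: lattice_basis_def)
  qed
  then obtain u where u: "\<And>j i. u j $ i \<in> \<int>" "\<And>j. A *v axis j 1 = B *v u j"
    by metis
  define U where "U = (\<chi> i j. u j $ i)"
  have "A = B ** U"
  proof -
    have "A $ i $ j = (B ** U) $ i $ j" for i j
    proof -
      have "A $ i $ j = (A *v axis j 1) $ i"
        by (simp add: matrix_vector_mul_component inner_axis)
      also have "\<dots> = (B *v u j) $ i"
        by (simp add: u)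
      also have "\<dots> = (B ** U) $ i $ j"
        by (simp add: matrix_vector_mult_def matrix_matrix_mult_def U_def)
      finally show ?thesis .
    qed
    then show ?thesis
      by (simp add: vec_eq_iff)
  qed
  moreover have "det U \<in> \<int>"
    unfolding det_def U_def by (auto intro!: Ints_sum Ints_mult Ints_prod u)
  ultimately show ?thesis
    by (rule that)
qed

lemma lattice_basis_det_le:
  fixes A B :: "real^'n^'n"
  assumes "lattice_basis A M" "lattice_basis B M"
  shows "\<bar>det B\<bar> \<le> \<bar>det A\<bar>"
proof -
  obtain U where U: "A = B ** U" "det U \<in> \<int>"
    using lattice_basis_change[OF assms] .
  have "det A \<noteq> 0"
    using assms(1) by (simp add: lattice_basis_def invertible_det_nz)
  then have "det U \<noteq> 0"
    using U by (auto simp: det_mul)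
  then have "1 \<le> \<bar>det U\<bar>"
    using U(2) Ints_nonzero_abs_ge1 by blast
  then have "\<bar>det B\<bar> * 1 \<le> \<bar>det B\<bar> * \<bar>det U\<bar>"
    by (intro mult_left_mono) auto
  then show ?thesis
    by (simp add: U(1) det_mul abs_mult)
qed

lemma covolume_eq:
  assumes "lattice_basis A M"
  shows "covolume M = \<bar>det A\<bar>"
  unfolding covolume_def
  using assms lattice_basis_det_le by (blast intro: the_equality order.antisym)

end

theory Submission
  imports Defs
begin

text \<open>
  Let \<open>d = CARD('n)\<close>. A nonzero \<open>v\<close> in the dual lattice with \<open>\<bar>v $ i\<bar> \<le> \<lambda> exp (\<tau> $ i)\<close> forces the
  lattice into widely spaced hyperplanes, so the sublattice orthogonal to \<open>v\<close> is dense and contains a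
  nonzero \<open>x\<close> with \<open>\<bar>x $ i\<bar> \<le> C \<lambda> powr (1 / (d - 1)) exp (- \<tau> $ i)\<close>. This gives one factor
  \<open>d - 1\<close>; the other one is \<open>plus_norm (- \<tau>) \<le> (d - 1) * plus_norm \<tau>\<close>. The constant \<open>C\<close> disappears
  in the limit, so Minkowski's theorem is only needed up to a constant, and the pigeonhole principle
  suffices.
\<close>

section \<open>Lattice points in boxes: rounding and counting\<close>

lemma full_rank_lattice_diff:
  assumes "full_rank_lattice M" "x \<in> M" "y \<in> M"
  shows "x - y \<in> M"
proof -
  obtain A where A: "lattice_basis A M"
    using assms(1) by (auto simp: full_rank_lattice_def)
  then obtain z w where "x = A *v z" "y = A *v w" "\<And>i. z $ i \<in> \<int>" "\<And>i. w $ i \<in> \<int>"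
    using assms(2,3) by (auto simp: lattice_basis_def)
  then have "x - y = A *v (z - w)" "\<And>i. (z - w) $ i \<in> \<int>"
    by (simp_all add: matrix_vector_mult_diff_distrib)
  then show ?thesis
    using A by (auto simp: lattice_basis_def)
qed

text \<open>Rounding down the coordinates with respect to a basis moves a point by the image of a
  vector with entries in \<open>[0, 1)\<close>, which the entries of the basis matrix bound.\<close>

lemma full_rank_lattice_covering:
  fixes M :: "(real^'n) set"
  assumes "full_rank_lattice M"
  obtains a where "a > 0" "\<And>x. \<exists>p\<in>M. \<forall>i. \<bar>x $ i - p $ i\<bar> \<le> a"
proof -
  obtain A :: "real^'n^'n" where A: "invertible A" "M = (\<lambda>z. A *v z) ` {z. \<forall>i. z $ i \<in> \<int>}"
    using assms by (auto simp: full_rank_lattice_def lattice_basis_def)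
  obtain A' where A': "A ** A' = mat 1"
    using A(1) by (auto simp: invertible_def)
  \<comment> \<open>The summand \<open>1\<close> gives \<open>a > 0\<close> without a look at the
    entries of \<open>A\<close>.\<close>
  define a where "a = (\<Sum>i\<in>UNIV. \<Sum>j\<in>UNIV. \<bar>A $ i $ j\<bar>) + 1"
  have "a > 0"
    unfolding a_def by (intro add_nonneg_pos sum_nonneg) auto
  moreover have "\<exists>p\<in>M. \<forall>i. \<bar>x $ i - p $ i\<bar> \<le> a" for x
  proof -
    define y where "y = A' *v x"
    define z :: "real^'n" where "z = (\<chi> i. of_int \<lfloor>y $ i\<rfloor>)"
    have x: "x = A *v y"
      by (simp add: y_def matrix_vector_mul_assoc A')
    have "A *v z \<in> M"
      using A(2) by (auto simp: z_def)
    moreover have "\<bar>x $ i - (A *v z) $ i\<bar> \<le> a" for i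
    proof -
      have "x $ i - (A *v z) $ i = (\<Sum>j\<in>UNIV. A $ i $ j * (y $ j - z $ j))"
        by (simp add: x matrix_vector_mult_def sum_subtractf algebra_simps)
      also have "\<bar>\<dots>\<bar> \<le> (\<Sum>j\<in>UNIV. \<bar>A $ i $ j\<bar> * 1)"
      proof (intro order_trans[OF sum_abs] sum_mono)
        fix j
        have "\<bar>y $ j - z $ j\<bar> \<le> 1"
          unfolding z_def by (simp add: abs_le_iff) linarith
        then show "\<bar>A $ i $ j * (y $ j - z $ j)\<bar> \<le> \<bar>A $ i $ j\<bar> * 1"
          unfolding abs_mult by (intro mult_left_mono) auto
      qed
      also have "\<dots> \<le> (\<Sum>i\<in>UNIV. \<Sum>j\<in>UNIV. \<bar>A $ i $ j\<bar>)"
        using member_le_sum[of i UNIV "\<lambda>i. \<Sum>j\<in>UNIV. \<bar>A $ i $ j\<bar>"] by (simp add: sum_nonneg)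
      finally show ?thesis by (simp add: a_def)
    qed
    ultimately show ?thesis by blast
  qed
  ultimately show ?thesis by (rule that)
qed

text \<open>
  Minkowski's linear forms theorem up to a constant depending on the lattice. The weights \<open>t\<close> are the
  side ratios of the large box whose lattice points are sorted into cells by the forms \<open>h\<close>.
\<close>
lemma lattice_linear_forms:
  fixes M :: "(real^'n) set"
  assumes M: "full_rank_lattice M"
  obtains K where "K > 0"
    "\<And>(t :: 'n \<Rightarrow> real) (c :: 'n \<Rightarrow> real) (h :: 'n \<Rightarrow> real^'n).
      (\<And>j. t j > 0) \<Longrightarrow> (\<And>i. c i > 0) \<Longrightarrow>
      K * (\<Prod>i\<in>UNIV. \<Sum>j\<in>UNIV. \<bar>h i $ j\<bar> * t j) < (\<Prod>i\<in>UNIV. c i) * (\<Prod>j\<in>UNIV. t j) \<Longrightarrow>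
      \<exists>x\<in>M. x \<noteq> 0 \<and> (\<forall>i. \<bar>h i \<bullet> x\<bar> < c i)"
proof -
  obtain a where a: "a > 0" "\<And>x. \<exists>p\<in>M. \<forall>i. \<bar>x $ i - p $ i\<bar> \<le> a"
    using full_rank_lattice_covering[OF M] by blast
  obtain P where P: "\<And>x. P x \<in> M" "\<And>x i. \<bar>x $ i - P x $ i\<bar> \<le> a"
    using a(2) by metis
  \<comment> \<open>In \<open>6 * a = 2 * (3 * a)\<close>, the number \<open>3 * a\<close> is the
    spacing of the grid whose points are rounded into \<open>M\<close>, and the \<open>2\<close>
    comes from the values of each form filling an interval symmetric about \<open>0\<close>.\<close>
  have "\<exists>x\<in>M. x \<noteq> 0 \<and> (\<forall>i. \<bar>h i \<bullet> x\<bar> < c i)"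
    if t: "\<And>j. t j > 0" and c: "\<And>i. c i > 0"
      and less: "(6 * a) ^ CARD('n) * (\<Prod>i\<in>UNIV. \<Sum>j\<in>UNIV. \<bar>h i $ j\<bar> * t j)
        < (\<Prod>i\<in>UNIV. c i) * (\<Prod>j\<in>UNIV. t j)"
    for t c :: "'n \<Rightarrow> real" and h :: "'n \<Rightarrow> real^'n"
  proof -
    define s where "s i = (\<Sum>j\<in>UNIV. \<bar>h i $ j\<bar> * t j)" for i
    have s: "s i \<ge> 0" for i
      unfolding s_def using t by (intro sum_nonneg mult_nonneg_nonneg) (auto simp: less_imp_le)
    \<comment> \<open>For a box of size \<open>T\<close> both counts grow like
      \<open>T ^ CARD('n)\<close>; these are the leading coefficients for the cells (left) and for
      the lattice points (right).\<close>
    have "(\<Prod>i\<in>UNIV. 2 * s i / c i) < (\<Prod>j\<in>UNIV. t j / (3 * a))"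
    proof -
      have "(6 * a) ^ CARD('n) = 2 ^ CARD('n) * (3 * a) ^ CARD('n)"
        using power_mult_distrib[of 2 "3 * a" "CARD('n)"] by simp
      moreover have "(\<Prod>i\<in>UNIV. c i) > 0"
        using c by (intro prod_pos) auto
      moreover have "p * q * x < y * z \<Longrightarrow> y > 0 \<Longrightarrow> q > 0 \<Longrightarrow> p * x / y < z / q"
        for p q x y z :: real
        by (simp add: field_simps)
      ultimately have "2 ^ CARD('n) * (\<Prod>i\<in>UNIV. s i) / (\<Prod>i\<in>UNIV. c i)
          < (\<Prod>j\<in>UNIV. t j) / (3 * a) ^ CARD('n)"
        using less a(1) unfolding s_def[symmetric] by simp
      then show ?thesis
        by (simp add: prod_dividef prod.distrib)
    qed
    moreover have tends: "((\<lambda>T. t j / (3 * a) - 1 / T) \<longlongrightarrow> t j / (3 * a) - 0) at_top" for j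
      by (intro tendsto_intros tendsto_divide_0[OF tendsto_const] filterlim_at_top_imp_at_infinity filterlim_ident)
    \<comment> \<open>The terms \<open>1 / T\<close> and \<open>2 / T\<close> are the rounding
      losses in the two counts after division by \<open>T\<close> in each factor. They vanish in the
      limit, so the strict inequality survives for some finite \<open>T\<close>.\<close>
    have "((\<lambda>T. (\<Prod>j\<in>UNIV. t j / (3 * a) - 1 / T) - (\<Prod>i\<in>UNIV. 2 * s i / c i + 2 / T))
        \<longlongrightarrow> (\<Prod>j\<in>UNIV. t j / (3 * a) - 0) - (\<Prod>i\<in>UNIV. 2 * s i / c i + 0)) at_top"
      by (intro tendsto_diff tendsto_prod tends tendsto_add tendsto_const
          tendsto_divide_0[OF tendsto_const] filterlim_at_top_imp_at_infinity filterlim_ident)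
    ultimately have "\<forall>\<^sub>F T in at_top.
        0 < (\<Prod>j\<in>UNIV. t j / (3 * a) - 1 / T) - (\<Prod>i\<in>UNIV. 2 * s i / c i + 2 / T)"
      by (intro order_tendstoD(1)) auto
    moreover have "\<forall>\<^sub>F T in at_top. \<forall>j\<in>UNIV. 0 < t j / (3 * a) - 1 / T"
      using t a(1) by (intro eventually_ball_finite ballI order_tendstoD(1)[OF tends]) auto
    moreover have "\<forall>\<^sub>F T in at_top. 0 < (T :: real)"
      by (rule eventually_gt_at_top)
    ultimately have "\<forall>\<^sub>F T in at_top.
        (0 < (\<Prod>j\<in>UNIV. t j / (3 * a) - 1 / T) - (\<Prod>i\<in>UNIV. 2 * s i / c i + 2 / T) \<and>
        (\<forall>j\<in>UNIV. 0 < t j / (3 * a) - 1 / T)) \<and> 0 < T"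
      by (intro eventually_conj)
    then obtain T where T: "(\<Prod>i\<in>UNIV. 2 * s i / c i + 2 / T) < (\<Prod>j\<in>UNIV. t j / (3 * a) - 1 / T)"
        "\<And>j. 0 < t j / (3 * a) - 1 / T" "T > 0"
      using eventually_happens[of _ "at_top :: real filter"] by auto
    define N where "N j = nat \<lfloor>T * t j / (3 * a)\<rfloor>" for j
    have N_le: "real (N j) \<le> T * t j / (3 * a)" for j
      using T(3) t[of j] a(1) unfolding N_def by (intro of_nat_floor) simp
    have N_ge: "T * (t j / (3 * a) - 1 / T) \<le> real (N j)" for j
    proof -
      have "T * (t j / (3 * a) - 1 / T) = T * t j / (3 * a) - 1"
        using T(3) by (simp add: field_simps)
      then show ?thesis unfolding N_def by linarith
    qed
    define D where "D = Pi\<^sub>E (UNIV :: 'n set) (\<lambda>j. {..<N j})"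
    \<comment> \<open>Grid points at distance \<open>3 * a\<close> are moved by at most
      \<open>a\<close> per coordinate, so different indices give different lattice points. Indices
      stop at \<open>N j - 1\<close>, which leaves room for this movement inside the box.\<close>
    define p where "p m = P (\<chi> j. 3 * a * real (m j))" for m :: "'n \<Rightarrow> nat"
    have p_near: "\<bar>3 * a * real (m j) - p m $ j\<bar> \<le> a" for m j
      using P(2)[of "\<chi> j. 3 * a * real (m j)" j] by (simp add: p_def)
    have p_bound: "\<bar>p m $ j\<bar> \<le> T * t j" if "m \<in> D" for m j
    proof -
      have "m j < N j" using that by (auto simp: D_def)
      then have "3 * a * (real (m j) + 1) \<le> 3 * a * real (N j)"
        using a(1) by (intro mult_left_mono) auto
      moreover have "3 * a * real (N j) \<le> T * t j"
        using N_le[of j] a(1) by (simp add: field_simps)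
      moreover have "0 \<le> 3 * a * real (m j)" using a(1) by simp
      ultimately show ?thesis
        using p_near[of m j] a(1) unfolding distrib_left by linarith
    qed
    define u where "u i = T * s i / c i" for i
    have form_bound: "- u i \<le> h i \<bullet> p m / c i \<and> h i \<bullet> p m / c i \<le> u i" if "m \<in> D" for m i
    proof -
      have "\<bar>h i \<bullet> p m\<bar> \<le> (\<Sum>j\<in>UNIV. \<bar>h i $ j\<bar> * (T * t j))"
        unfolding inner_vec_def using p_bound[OF that]
        by (intro order_trans[OF sum_abs] sum_mono) (auto simp: abs_mult intro!: mult_left_mono)
      also have "\<dots> = T * s i"
        by (simp add: s_def sum_distrib_left mult_ac)
      finally have "\<bar>h i \<bullet> p m / c i\<bar> \<le> u i"
        using c[of i] by (simp add: u_def abs_divide divide_right_mono)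
      then show ?thesis by linarith
    qed
    \<comment> \<open>The cell of a lattice point: each form is measured in units of
      \<open>c i\<close>, so two points in one cell have a difference on which form \<open>i\<close>
      is below \<open>c i\<close>.\<close>
    define q where "q m = (\<lambda>i. \<lfloor>h i \<bullet> p m / c i\<rfloor>)" for m
    define E where "E = Pi\<^sub>E (UNIV :: 'n set) (\<lambda>i. {\<lfloor>- u i\<rfloor>..\<lfloor>u i\<rfloor>})"
    have "finite E" unfolding E_def by (intro finite_PiE) auto
    have "q ` D \<subseteq> E"
      using form_bound unfolding q_def E_def by (auto intro!: floor_mono)
    moreover have "card E < card D"
    proof -
      have "real (card E) = (\<Prod>i\<in>UNIV. real (nat (\<lfloor>u i\<rfloor> - \<lfloor>- u i\<rfloor> + 1)))"
        by (simp add: E_def card_PiE)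
      also have "\<dots> \<le> (\<Prod>i\<in>UNIV. T * (2 * s i / c i + 2 / T))"
      proof (intro prod_mono conjI)
        fix i
        have "u i \<ge> 0" using T(3) s[of i] c[of i] by (simp add: u_def)
        \<comment> \<open>Rounding costs nothing at the upper end and less than \<open>1\<close> at
          the lower end; the count of integers adds another \<open>1\<close>.\<close>
        then have "real (nat (\<lfloor>u i\<rfloor> - \<lfloor>- u i\<rfloor> + 1)) \<le> 2 * u i + 2"
          by linarith
        also have "\<dots> = T * (2 * s i / c i + 2 / T)"
          using T(3) by (simp add: u_def distrib_left)
        finally show "real (nat (\<lfloor>u i\<rfloor> - \<lfloor>- u i\<rfloor> + 1)) \<le> T * (2 * s i / c i + 2 / T)" .
      qed simp
      also have "\<dots> < (\<Prod>j\<in>UNIV. T * (t j / (3 * a) - 1 / T))"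
        using T(1,3) by (simp add: prod.distrib)
      also have "\<dots> \<le> (\<Prod>j\<in>UNIV. real (N j))"
        using N_ge T(2,3) by (intro prod_mono) (auto simp: less_imp_le)
      also have "\<dots> = real (card D)"
        by (simp add: D_def card_PiE)
      finally show ?thesis by simp
    qed
    ultimately have "\<not> inj_on q D"
      using \<open>finite E\<close> by (meson card_mono le_less_trans pigeonhole)
    then obtain m m' where m: "q m = q m'" "m \<noteq> m'"
      by (auto simp: inj_on_def)
    define x where "x = p m - p m'"
    have "x \<in> M"
      unfolding x_def p_def by (intro full_rank_lattice_diff[OF M] P)
    moreover have "x \<noteq> 0"
    proof -
      obtain j where "m j \<noteq> m' j" using m(2) by auto
      then have "1 \<le> \<bar>real (m j) - real (m' j)\<bar>" by linarith
      then have "3 * a * 1 \<le> 3 * a * \<bar>real (m j) - real (m' j)\<bar>"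
        using a(1) by (intro mult_left_mono) auto
      also have "\<dots> = \<bar>3 * a * real (m j) - 3 * a * real (m' j)\<bar>"
        using a(1) by (simp add: abs_mult flip: right_diff_distrib)
      finally have "x $ j \<noteq> 0"
        using p_near[of m j] p_near[of m' j] a(1) by (simp add: x_def)
      then show ?thesis by auto
    qed
    moreover have "\<bar>h i \<bullet> x\<bar> < c i" for i
    proof -
      have "\<lfloor>h i \<bullet> p m / c i\<rfloor> = \<lfloor>h i \<bullet> p m' / c i\<rfloor>"
        using m(1) by (simp add: q_def fun_eq_iff)
      then have "\<bar>h i \<bullet> p m / c i - h i \<bullet> p m' / c i\<bar> < 1"
        by linarith
      then show ?thesis
        using c[of i] by (simp add: x_def inner_diff_right abs_divide flip: diff_divide_distrib)
    qed
    ultimately show ?thesis by blast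
  qed
  moreover have "(6 * a) ^ CARD('n) > 0" using a(1) by simp
  ultimately show ?thesis using that by blast
qed

section \<open>Short vectors for trace-zero exponents, directly and from a dual vector\<close>

lemma trace_zero_prod_exp:
  assumes "\<tau> \<in> trace_zero"
  shows "(\<Prod>i\<in>UNIV. exp (\<tau> $ i)) = 1" "(\<Prod>i\<in>UNIV. exp (- \<tau> $ i)) = 1"
  using assms by (simp_all add: trace_zero_def exp_sum[symmetric] sum_negf)

text \<open>Apply the linear forms bound to the coordinates: the weights multiply to
  \<open>1\<close>, so one constant serves all \<tau>. It bounds \<open>L 1 M \<tau>\<close> from
  above, and \<open>r > 1\<close> makes its logarithm positive.\<close>

lemma lattice_short_vector_bounded:
  fixes M :: "(real^'n) set"
  assumes M: "full_rank_lattice M"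
  obtains r where "r > 1"
    "\<And>\<tau>. \<tau> \<in> trace_zero \<Longrightarrow> \<exists>x\<in>M. x \<noteq> 0 \<and> (\<forall>i. \<bar>x $ i\<bar> \<le> r * exp (\<tau> $ i))"
proof -
  obtain K where K: "K > 0" "\<And>(t :: 'n \<Rightarrow> real) (c :: 'n \<Rightarrow> real) (h :: 'n \<Rightarrow> real^'n).
      (\<And>j. t j > 0) \<Longrightarrow> (\<And>i. c i > 0) \<Longrightarrow>
      K * (\<Prod>i\<in>UNIV. \<Sum>j\<in>UNIV. \<bar>h i $ j\<bar> * t j) < (\<Prod>i\<in>UNIV. c i) * (\<Prod>j\<in>UNIV. t j) \<Longrightarrow>
      \<exists>x\<in>M. x \<noteq> 0 \<and> (\<forall>i. \<bar>h i \<bullet> x\<bar> < c i)"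
    using lattice_linear_forms[OF M] by blast
  have "\<exists>x\<in>M. x \<noteq> 0 \<and> (\<forall>i. \<bar>x $ i\<bar> \<le> (K + 1) * exp (\<tau> $ i))" if \<tau>: "\<tau> \<in> trace_zero" for \<tau>
  proof -
    have "(\<Sum>j\<in>UNIV. \<bar>axis i 1 $ j\<bar> * exp (\<tau> $ j)) = exp (\<tau> $ i)" for i
      by (simp add: axis_def if_distrib[of abs] if_distrib[of "\<lambda>x. x * _"] cong: if_cong)
    moreover have "K < (K + 1) ^ CARD('n)"
      using power_increasing[of 1 "CARD('n)" "K + 1"] K(1) by (simp add: Suc_leI)
    ultimately have "\<exists>x\<in>M. x \<noteq> 0 \<and> (\<forall>i. \<bar>axis i 1 \<bullet> x\<bar> < (K + 1) * exp (\<tau> $ i))"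
      using K(1) by (intro K(2)[of "\<lambda>i. exp (\<tau> $ i)"])
        (auto simp: prod.distrib trace_zero_prod_exp[OF \<tau>])
    then show ?thesis
      by (auto simp: inner_commute[of "axis _ _"] inner_axis intro: less_imp_le)
  qed
  then show ?thesis using that[of "K + 1"] K(1) by auto
qed

text \<open>
  The coordinate \<open>k\<close> with the largest \<open>\<bar>v $ k\<bar> * exp (- \<tau> $ k)\<close> is replaced by the integer-valued
  form \<open>v \<bullet> x\<close>; once that form vanishes, the dropped coordinate is controlled by the others.
\<close>
lemma dual_vector_transference:
  fixes M :: "(real^'n) set"
  assumes d: "CARD('n) \<ge> 2" and M: "full_rank_lattice M"
  obtains K where "K > 0"
    "\<And>\<tau> v l R. \<tau> \<in> trace_zero \<Longrightarrow> v \<in> dual_lattice M \<Longrightarrow> v \<noteq> 0 \<Longrightarrow>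
      (\<And>i. \<bar>v $ i\<bar> \<le> l * exp (\<tau> $ i)) \<Longrightarrow> R > 0 \<Longrightarrow> K * l < R ^ (CARD('n) - 1) \<Longrightarrow>
      \<exists>x\<in>M. x \<noteq> 0 \<and> (\<forall>i. \<bar>x $ i\<bar> \<le> (real CARD('n) - 1) * R * exp (- \<tau> $ i))"
proof -
  obtain K where K: "K > 0" "\<And>(t :: 'n \<Rightarrow> real) (c :: 'n \<Rightarrow> real) (h :: 'n \<Rightarrow> real^'n).
      (\<And>j. t j > 0) \<Longrightarrow> (\<And>i. c i > 0) \<Longrightarrow>
      K * (\<Prod>i\<in>UNIV. \<Sum>j\<in>UNIV. \<bar>h i $ j\<bar> * t j) < (\<Prod>i\<in>UNIV. c i) * (\<Prod>j\<in>UNIV. t j) \<Longrightarrow>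
      \<exists>x\<in>M. x \<noteq> 0 \<and> (\<forall>i. \<bar>h i \<bullet> x\<bar> < c i)"
    using lattice_linear_forms[OF M] by blast
  have "\<exists>x\<in>M. x \<noteq> 0 \<and> (\<forall>i. \<bar>x $ i\<bar> \<le> (real CARD('n) - 1) * R * exp (- \<tau> $ i))"
    if \<tau>: "\<tau> \<in> trace_zero" and v: "v \<in> dual_lattice M" "v \<noteq> 0" "\<And>i. \<bar>v $ i\<bar> \<le> l * exp (\<tau> $ i)"
      and R: "R > 0" "K * real CARD('n) * l < R ^ (CARD('n) - 1)"
    for \<tau> v l R
  proof -
    define t where "t i = exp (- \<tau> $ i)" for i
    have t: "t i > 0" for i by (simp add: t_def)
    define w where "w i = \<bar>v $ i\<bar> * t i" for i
    have w_le: "w i \<le> l" for i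
      using v(3)[of i] by (simp add: w_def t_def exp_minus field_simps)
    obtain k where k: "\<And>i. w i \<le> w k"
    proof -
      have "Max (range w) \<in> range w" by (rule Max_in) auto
      then obtain k where "Max (range w) = w k" by (metis rangeE)
      then have "w i \<le> w k" for i by (metis Max_ge finite finite_imageI rangeI)
      then show ?thesis by (rule that)
    qed
    obtain j where "v $ j \<noteq> 0" using v(2) by (auto simp: vec_eq_iff)
    then have "w j > 0" by (simp add: w_def t)
    then have wk: "w k > 0" using k[of j] by linarith
    \<comment> \<open>The bound \<open>1\<close> on the form \<open>v\<close> will force the integer
      \<open>v \<bullet> x\<close> to vanish.\<close>
    define h where "h i = (if i = k then v else axis i 1)" for i
    define c where "c i = (if i = k then 1 else R * t i)" for i
    have split: "(\<Prod>i\<in>UNIV. f i) = f k * (\<Prod>i\<in>UNIV - {k}. f i)" for f :: "'n \<Rightarrow> real"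
      by (rule prod.remove) auto
    \<comment> \<open>This product over the kept coordinates occurs on both sides of the counting
      condition and cancels.\<close>
    define \<pi> where "\<pi> = (\<Prod>i\<in>UNIV - {k}. t i)"
    have \<pi>: "\<pi> > 0" unfolding \<pi>_def using t by (intro prod_pos) auto
    have prodt: "(\<Prod>i\<in>UNIV. t i) = 1"
      unfolding t_def by (rule trace_zero_prod_exp[OF \<tau>])
    have "(\<Prod>i\<in>UNIV. c i) = R ^ (CARD('n) - 1) * \<pi>"
      unfolding split \<pi>_def by (simp add: c_def prod.distrib)
    moreover have "(\<Prod>i\<in>UNIV. \<Sum>j\<in>UNIV. \<bar>h i $ j\<bar> * t j) = (\<Sum>j\<in>UNIV. w j) * \<pi>"
    proof -
      have "(\<Sum>j\<in>UNIV. \<bar>axis i 1 $ j\<bar> * t j) = t i" for i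
        by (simp add: axis_def if_distrib[of abs] if_distrib[of "\<lambda>x. x * _"] cong: if_cong)
      then show ?thesis unfolding split \<pi>_def by (simp add: h_def w_def)
    qed
    \<comment> \<open>Bounding each \<open>w j\<close> by \<open>l\<close> is where the factor
      \<open>CARD('n)\<close> enters the final constant.\<close>
    moreover have "K * (\<Sum>j\<in>UNIV. w j) < R ^ (CARD('n) - 1)"
    proof -
      have "(\<Sum>j\<in>UNIV. w j) \<le> real CARD('n) * l"
        using sum_bounded_above[of UNIV w l] w_le by simp
      then have "K * (\<Sum>j\<in>UNIV. w j) \<le> K * (real CARD('n) * l)"
        using K(1) by (intro mult_left_mono) auto
      then show ?thesis using R(2) by (simp add: mult.assoc)
    qed
    ultimately have "\<exists>x\<in>M. x \<noteq> 0 \<and> (\<forall>i. \<bar>h i \<bullet> x\<bar> < c i)"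
      using t R(1) \<pi> by (intro K(2)[of t]) (auto simp: c_def prodt mult.assoc[symmetric])
    then obtain x where x: "x \<in> M" "x \<noteq> 0" "\<And>i. \<bar>h i \<bullet> x\<bar> < c i" by blast
    have x_less: "\<bar>x $ i\<bar> < R * t i" if "i \<noteq> k" for i
      using x(3)[of i] that by (simp add: h_def c_def inner_commute[of "axis _ _"] inner_axis)
    have "\<bar>v \<bullet> x\<bar> < 1"
      using x(3)[of k] by (simp add: h_def c_def)
    moreover have "v \<bullet> x \<in> \<int>"
      using v(1) x(1) by (auto simp: dual_lattice_def inner_commute)
    ultimately have "v \<bullet> x = 0"
      using Ints_nonzero_abs_ge1 by force
    then have "v $ k * x $ k = - (\<Sum>i\<in>UNIV - {k}. v $ i * x $ i)"
      by (simp add: inner_vec_def sum.remove[of UNIV k])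
    then have "\<bar>v $ k\<bar> * \<bar>x $ k\<bar> = \<bar>\<Sum>i\<in>UNIV - {k}. v $ i * x $ i\<bar>"
      by (simp flip: abs_mult)
    \<comment> \<open>Maximality of \<open>w k\<close> bounds each of the
      \<open>CARD('n) - 1\<close> remaining terms alike; dividing by the nonzero
      \<open>v $ k\<close> then bounds \<open>x $ k\<close>.\<close>
    also have "\<dots> \<le> (\<Sum>i\<in>UNIV - {k}. w k * R)"
    proof (intro order_trans[OF sum_abs] sum_mono)
      fix i assume "i \<in> UNIV - {k}"
      then have "\<bar>v $ i * x $ i\<bar> \<le> \<bar>v $ i\<bar> * (R * t i)"
        using x_less[of i] by (auto simp: abs_mult intro!: mult_left_mono)
      also have "\<dots> = w i * R" by (simp add: w_def)
      also have "\<dots> \<le> w k * R" using k R(1) by (intro mult_right_mono) auto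
      finally show "\<bar>v $ i * x $ i\<bar> \<le> w k * R" .
    qed
    also have "\<dots> = \<bar>v $ k\<bar> * ((real CARD('n) - 1) * R * t k)"
      using d by (simp add: of_nat_diff w_def)
    finally have xk: "\<bar>x $ k\<bar> \<le> (real CARD('n) - 1) * R * t k"
      using wk t[of k] by (simp add: w_def zero_less_mult_iff)
    have "\<bar>x $ i\<bar> \<le> (real CARD('n) - 1) * R * t i" for i
    proof (cases "i = k")
      case False
      have "1 * (R * t i) \<le> (real CARD('n) - 1) * (R * t i)"
        using d R(1) t[of i] by (intro mult_right_mono) auto
      then show ?thesis using x_less[OF False] by (simp add: mult.assoc)
    qed (use xk in simp)
    then show ?thesis using x unfolding t_def by blast
  qed
  then show ?thesis using that[of "K * real CARD('n)"] K(1) by auto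
qed

section \<open>The first minimum in coordinates\<close>

lemma diag_exp_mult_component: "(diag_exp \<tau> *v x) $ i = exp (\<tau> $ i) * x $ i"
  by (simp add: diag_exp_def matrix_vector_mult_def if_distrib[of "\<lambda>x. x * _"] cong: if_cong)

text \<open>An independent set of size one is a single nonzero vector, and the scaled ball is a
  coordinate box.\<close>

lemma first_minimum_eq:
  fixes M :: "(real^'n) set"
  shows "successive_minimum 1 (scaled_ball \<tau>) M =
     Inf {l. l > 0 \<and> (\<exists>x\<in>M. x \<noteq> 0 \<and> (\<forall>i. \<bar>x $ i\<bar> \<le> l * exp (\<tau> $ i)))}"
proof -
  have ball: "x \<in> (*\<^sub>R) l ` scaled_ball \<tau> \<longleftrightarrow> (\<forall>i. \<bar>x $ i\<bar> \<le> l * exp (\<tau> $ i))"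
    if "l > 0" for l :: real and x :: "real^'n"
  proof
    assume "x \<in> (*\<^sub>R) l ` scaled_ball \<tau>"
    then obtain u where u: "infnorm u \<le> 1" "x = l *\<^sub>R (diag_exp \<tau> *v u)"
      by (auto simp: scaled_ball_def sup_ball_def)
    have "\<bar>u $ i\<bar> \<le> 1" for i
      using component_le_infnorm_cart[of u i] u(1) by linarith
    then show "\<forall>i. \<bar>x $ i\<bar> \<le> l * exp (\<tau> $ i)"
      using that by (simp add: u(2) diag_exp_mult_component abs_mult mult_left_le)
  next
    assume x: "\<forall>i. \<bar>x $ i\<bar> \<le> l * exp (\<tau> $ i)"
    define u :: "real^'n" where "u = (\<chi> i. x $ i / (l * exp (\<tau> $ i)))"
    have "\<bar>u $ i\<bar> \<le> 1" for i
      using x that by (simp add: u_def abs_mult divide_le_eq)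
    then have "u \<in> sup_ball"
      unfolding sup_ball_def infnorm_cart by (auto intro!: cSup_least)
    moreover have "x = l *\<^sub>R (diag_exp \<tau> *v u)"
      using that by (simp add: vec_eq_iff diag_exp_mult_component u_def)
    ultimately show "x \<in> (*\<^sub>R) l ` scaled_ball \<tau>"
      by (auto simp: scaled_ball_def)
  qed
  have "(\<exists>S. S \<subseteq> M \<inter> (*\<^sub>R) l ` scaled_ball \<tau> \<and> independent S \<and> card S = 1)
      \<longleftrightarrow> (\<exists>x\<in>M. x \<noteq> 0 \<and> (\<forall>i. \<bar>x $ i\<bar> \<le> l * exp (\<tau> $ i)))" if l: "l > 0" for l
  proof
    assume "\<exists>S. S \<subseteq> M \<inter> (*\<^sub>R) l ` scaled_ball \<tau> \<and> independent S \<and> card S = 1"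
    then obtain x where "{x} \<subseteq> M \<inter> (*\<^sub>R) l ` scaled_ball \<tau>" "independent {x}"
      by (metis card_1_singletonE)
    then show "\<exists>x\<in>M. x \<noteq> 0 \<and> (\<forall>i. \<bar>x $ i\<bar> \<le> l * exp (\<tau> $ i))"
      unfolding ball[OF l, symmetric] by auto
  next
    assume "\<exists>x\<in>M. x \<noteq> 0 \<and> (\<forall>i. \<bar>x $ i\<bar> \<le> l * exp (\<tau> $ i))"
    then obtain x where "x \<in> M" "x \<noteq> 0" "x \<in> (*\<^sub>R) l ` scaled_ball \<tau>"
      unfolding ball[OF l, symmetric] by auto
    then show "\<exists>S. S \<subseteq> M \<inter> (*\<^sub>R) l ` scaled_ball \<tau> \<and> independent S \<and> card S = 1"
      by (intro exI[of _ "{x}"]) (simp only: dependent_single, simp)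
  qed
  then show ?thesis
    unfolding successive_minimum_def by (metis (no_types, lifting))
qed

text \<open>The inverse basis matrix is bounded and sends nonzero lattice points to nonzero integer
  vectors, whose norm is at least \<open>1\<close>. This keeps the first minimum away from
  \<open>0\<close>.\<close>

lemma full_rank_lattice_nonzero_norm_ge:
  fixes M :: "(real^'n) set"
  assumes "full_rank_lattice M"
  obtains e where "e > 0" "\<And>x. x \<in> M \<Longrightarrow> x \<noteq> 0 \<Longrightarrow> e \<le> norm x"
proof -
  obtain A :: "real^'n^'n" where A: "invertible A" "M = (\<lambda>z. A *v z) ` {z. \<forall>i. z $ i \<in> \<int>}"
    using assms by (auto simp: full_rank_lattice_def lattice_basis_def)
  obtain A' where A': "A' ** A = mat 1"
    using A(1) by (auto simp: invertible_def)
  obtain K where K: "K > 0" "\<And>x. norm (A' *v x) \<le> norm x * K"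
    using bounded_linear.pos_bounded[OF matrix_vector_mul_bounded_linear[of A']] by blast
  have "inverse K \<le> norm x" if x: "x \<in> M" "x \<noteq> 0" for x
  proof -
    obtain z where z: "x = A *v z" "\<And>i. z $ i \<in> \<int>"
      using x A(2) by auto
    obtain j where "z $ j \<noteq> 0"
      using x(2) z(1) by (metis matrix_vector_mult_0_right vec_eq_iff zero_index)
    then have "1 \<le> norm z"
      using Ints_nonzero_abs_ge1[OF z(2)] component_le_norm_cart order_trans by blast
    also have "\<dots> \<le> norm x * K"
      using K(2)[of x] by (simp add: z(1) matrix_vector_mul_assoc A')
    finally show ?thesis
      using K(1) by (simp add: field_simps)
  qed
  then show ?thesis
    using that[of "inverse K"] K(1) by simp
qed

text \<open>The point is positivity of the infimum, since \<open>ln\<close> is monotone only on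
  positive reals and \<open>ln 0 = 0\<close> by convention.\<close>

lemma L_le_ln:
  assumes M: "full_rank_lattice M" and x: "x \<in> M" "x \<noteq> 0" "\<And>i. \<bar>x $ i\<bar> \<le> l * exp (\<tau> $ i)"
  shows "L 1 M \<tau> \<le> ln l"
proof -
  define X where "X = {l. l > 0 \<and> (\<exists>x\<in>M. x \<noteq> 0 \<and> (\<forall>i. \<bar>x $ i\<bar> \<le> l * exp (\<tau> $ i)))}"
  obtain j where "x $ j \<noteq> 0"
    using x(2) by (auto simp: vec_eq_iff)
  then have "l > 0"
    using x(3)[of j] by (smt (verit) exp_gt_zero mult_nonpos_nonneg)
  then have "l \<in> X" using x by (auto simp: X_def)
  obtain e where e: "e > 0" "\<And>x. x \<in> M \<Longrightarrow> x \<noteq> 0 \<Longrightarrow> e \<le> norm x"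
    using full_rank_lattice_nonzero_norm_ge[OF M] by blast
  \<comment> \<open>A vector admissible for \<open>t\<close> has l1-norm at most
    \<open>t * s\<close>, so \<open>e / s\<close> is a positive lower bound for
    \<open>X\<close>.\<close>
  define s where "s = (\<Sum>i\<in>UNIV. exp (\<tau> $ i))"
  have s: "s > 0" unfolding s_def by (intro sum_pos) auto
  have lower: "e / s \<le> t" if t: "t \<in> X" for t
  proof -
    obtain u where u: "u \<in> M" "u \<noteq> 0" "\<And>i. \<bar>u $ i\<bar> \<le> t * exp (\<tau> $ i)"
      using t by (auto simp: X_def)
    have "e \<le> norm u" using e(2) u by blast
    also have "\<dots> \<le> (\<Sum>i\<in>UNIV. \<bar>u $ i\<bar>)" by (rule norm_le_l1_cart)
    also have "\<dots> \<le> t * s" unfolding s_def sum_distrib_left by (intro sum_mono u)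
    finally show ?thesis using s by (simp add: field_simps)
  qed
  then have "e / s \<le> Inf X" using \<open>l \<in> X\<close> by (intro cInf_greatest) auto
  moreover have "e / s > 0" using e s by simp
  moreover have "Inf X \<le> l" using \<open>l \<in> X\<close> lower by (intro cInf_lower) (auto simp: bdd_below_def)
  ultimately show ?thesis
    unfolding L_def first_minimum_eq X_def[symmetric] using \<open>l > 0\<close> by simp
qed

text \<open>Converse direction, to be applied to the dual lattice. The vector \<open>u\<close> makes
  the set of admissible factors nonempty, so that its infimum is approached by members.\<close>

lemma L_less_imp_short_vector:
  assumes "u \<in> M" "u \<noteq> 0" and less: "L 1 M \<tau> < b"
  obtains x where "x \<in> M" "x \<noteq> 0" "\<And>i. \<bar>x $ i\<bar> \<le> exp b * exp (\<tau> $ i)"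
proof -
  define X where "X = {l. l > 0 \<and> (\<exists>x\<in>M. x \<noteq> 0 \<and> (\<forall>i. \<bar>x $ i\<bar> \<le> l * exp (\<tau> $ i)))}"
  define l where "l = (\<Sum>i\<in>UNIV. \<bar>u $ i\<bar> * exp (- \<tau> $ i)) + 1"
  have "\<bar>u $ i\<bar> * exp (- \<tau> $ i) \<le> (\<Sum>i\<in>UNIV. \<bar>u $ i\<bar> * exp (- \<tau> $ i))" for i
    by (rule member_le_sum) auto
  then have "\<bar>u $ i\<bar> * exp (- \<tau> $ i) \<le> l" for i
    unfolding l_def by (smt (verit))
  then have "\<bar>u $ i\<bar> \<le> l * exp (\<tau> $ i)" for i
    by (simp add: exp_minus field_simps)
  moreover have "l > 0"
    unfolding l_def by (intro add_nonneg_pos sum_nonneg) auto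
  ultimately have "l \<in> X" using assms by (auto simp: X_def)
  then have ne: "X \<noteq> {}" by auto
  have "0 \<le> Inf X" using ne by (intro cInf_greatest) (auto simp: X_def)
  moreover have "ln (Inf X) < b"
    using less unfolding L_def first_minimum_eq X_def .
  \<comment> \<open>Either \<open>Inf X = 0\<close>, which is below \<open>exp b\<close>, or the
    logarithm can be inverted.\<close>
  ultimately have "Inf X < exp b"
    by (metis exp_gt_zero exp_less_mono exp_ln less_eq_real_def)
  then obtain t where t: "t \<in> X" "t < exp b"
    using cInf_lessD[OF ne] by blast
  then obtain x where x: "x \<in> M" "x \<noteq> 0" "\<And>i. \<bar>x $ i\<bar> \<le> t * exp (\<tau> $ i)"
    by (auto simp: X_def)
  have "\<bar>x $ i\<bar> \<le> exp b * exp (\<tau> $ i)" for i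
    using x(3)[of i] t(2) by (smt (verit) exp_gt_zero mult_right_mono)
  then show ?thesis using that x by blast
qed

text \<open>A row of the inverse basis matrix is a dual basis vector: its product with
  \<open>A *v z\<close> is a coordinate of \<open>z\<close>.\<close>

lemma dual_lattice_nonzero:
  fixes M :: "(real^'n) set"
  assumes "full_rank_lattice M"
  obtains u where "u \<in> dual_lattice M" "u \<noteq> 0"
proof -
  obtain A :: "real^'n^'n" where A: "invertible A" "M = (\<lambda>z. A *v z) ` {z. \<forall>i. z $ i \<in> \<int>}"
    using assms by (auto simp: full_rank_lattice_def lattice_basis_def)
  obtain A' where A': "A' ** A = mat 1"
    using A(1) by (auto simp: invertible_def)
  fix k :: 'n
  define u where "u = A' $ k"
  have comp: "(A *v z) \<bullet> u = z $ k" for z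
  proof -
    have "(A *v z) \<bullet> u = (A' *v (A *v z)) $ k"
      by (simp add: matrix_vector_mul_component u_def inner_commute)
    then show ?thesis by (simp add: matrix_vector_mul_assoc A')
  qed
  have "u \<noteq> 0"
    using comp[of "axis k 1"] by auto
  moreover have "u \<in> dual_lattice M"
    using comp by (auto simp: dual_lattice_def A(2))
  ultimately show ?thesis using that by blast
qed

section \<open>Comparing norms on trace-zero vectors, and the sign of the exponent\<close>

lemma le_plus_norm: "\<tau> $ i \<le> plus_norm \<tau>"
  unfolding plus_norm_def by (intro Max_ge) auto

lemma trace_zero_uminus_le_plus_norm:
  fixes \<tau> :: "real^'n"
  assumes "\<tau> \<in> trace_zero"
  shows "- \<tau> $ i \<le> (real CARD('n) - 1) * plus_norm \<tau>"
proof -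
  have "- \<tau> $ i = (\<Sum>j\<in>UNIV - {i}. \<tau> $ j)"
    using assms by (simp add: trace_zero_def sum.remove[of UNIV i])
  also have "\<dots> \<le> (\<Sum>j\<in>UNIV - {i}. plus_norm \<tau>)"
    by (intro sum_mono le_plus_norm)
  also have "\<dots> = (real CARD('n) - 1) * plus_norm \<tau>"
    by (simp add: of_nat_diff Suc_leI)
  finally show ?thesis .
qed

lemma plus_norm_uminus_le:
  fixes \<tau> :: "real^'n"
  assumes "\<tau> \<in> trace_zero"
  shows "plus_norm (- \<tau>) \<le> (real CARD('n) - 1) * plus_norm \<tau>"
  using trace_zero_uminus_le_plus_norm[OF assms] by (auto simp: plus_norm_def[of "- \<tau>"])

text \<open>Hence \<open>plus_norm\<close> tends to infinity with \<open>infnorm\<close>, which lets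
  additive constants in \<open>L\<close> be absorbed.\<close>

lemma infnorm_le_plus_norm:
  fixes \<tau> :: "real^'n"
  assumes "\<tau> \<in> trace_zero" "CARD('n) \<ge> 2"
  shows "infnorm \<tau> \<le> (real CARD('n) - 1) * plus_norm \<tau>"
proof -
  let ?d = "real CARD('n) - 1"
  have d: "?d \<ge> 1" using assms(2) by simp
  \<comment> \<open>A negative maximum would make both a coordinate and its negative at most
    \<open>0\<close>, the former strictly; \<open>undefined\<close> is just some index.\<close>
  have nonneg: "0 \<le> plus_norm \<tau>"
  proof (rule ccontr)
    assume neg: "\<not> ?thesis"
    then have "?d * plus_norm \<tau> \<le> 0" using d by (simp add: mult_nonneg_nonpos)
    then show False
      using trace_zero_uminus_le_plus_norm[OF assms(1), of undefined] le_plus_norm[of \<tau> undefined] neg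
      by linarith
  qed
  have "\<bar>\<tau> $ i\<bar> \<le> ?d * plus_norm \<tau>" for i
    using trace_zero_uminus_le_plus_norm[OF assms(1), of i] le_plus_norm[of \<tau> i]
      mult_right_mono[OF d nonneg] by linarith
  then show ?thesis
    unfolding infnorm_cart by (auto intro!: cSup_least)
qed

lemma eventually_infnorm_trace_zero_iff:
  "eventually P (inf (filtercomap infnorm at_top) (principal trace_zero)) \<longleftrightarrow>
     (\<exists>N. \<forall>\<tau>\<in>trace_zero. N \<le> infnorm \<tau> \<longrightarrow> P \<tau>)"
  unfolding eventually_inf_principal eventually_filtercomap_at_top_linorder by blast

text \<open>The filter in \<open>psi_lower\<close> is therefore proper, and an eventual lower bound
  can be tested at an actual point.\<close>

lemma trace_zero_unbounded:
  assumes "CARD('n) \<ge> 2"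
  obtains \<tau> :: "real^'n" where "\<tau> \<in> trace_zero" "N \<le> infnorm \<tau>"
proof -
  obtain i j :: 'n where "i \<noteq> j"
    using assms by (metis card_le_Suc0_iff_eq finite not_less_eq_eq numeral_2_eq_2)
  define \<tau> :: "real^'n" where "\<tau> = axis i (\<bar>N\<bar>) - axis j (\<bar>N\<bar>)"
  have "\<tau> \<in> trace_zero"
    by (simp add: trace_zero_def \<tau>_def sum_subtractf axis_def)
  moreover have "\<tau> $ i = \<bar>N\<bar>"
    using \<open>i \<noteq> j\<close> by (simp add: \<tau>_def axis_def)
  then have "N \<le> infnorm \<tau>"
    using component_le_infnorm_cart[of \<tau> i] by simp
  ultimately show ?thesis using that by blast
qed

text \<open>\<open>L 1 M\<close> is bounded above while \<open>plus_norm\<close> is unbounded. The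
  sign is needed later, where multiplication by a negative number must reverse an
  inequality.\<close>

lemma psi_lower_plus_norm_nonpos:
  fixes M :: "(real^'n) set"
  assumes d: "CARD('n) \<ge> 2" and M: "full_rank_lattice M"
  shows "psi_lower 1 M plus_norm \<le> 0"
proof (rule ccontr)
  obtain r where r: "r > 1"
    "\<And>\<tau>. \<tau> \<in> trace_zero \<Longrightarrow> \<exists>x\<in>M. x \<noteq> 0 \<and> (\<forall>i. \<bar>x $ i\<bar> \<le> r * exp (\<tau> $ i))"
    using lattice_short_vector_bounded[OF M] by blast
  assume "\<not> ?thesis"
  then obtain q where q: "0 < ereal q" "ereal q < psi_lower 1 M plus_norm"
    using ereal_dense2 not_le by metis
  then have "\<forall>\<^sub>F \<tau> in inf (filtercomap infnorm at_top) (principal trace_zero).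
      ereal q < ereal (L 1 M \<tau> / plus_norm \<tau>)"
    unfolding psi_lower_def by (auto dest: less_LiminfD)
  then obtain N where N: "\<And>\<tau>. \<tau> \<in> trace_zero \<Longrightarrow> N \<le> infnorm \<tau> \<Longrightarrow> q < L 1 M \<tau> / plus_norm \<tau>"
    unfolding eventually_infnorm_trace_zero_iff by auto
  obtain \<tau> :: "real^'n" where \<tau>: "\<tau> \<in> trace_zero" "max N ((real CARD('n) - 1) * (ln r / q)) \<le> infnorm \<tau>"
    using trace_zero_unbounded[OF d] by blast
  have "(real CARD('n) - 1) * (ln r / q) \<le> (real CARD('n) - 1) * plus_norm \<tau>"
    using \<tau> infnorm_le_plus_norm[OF \<tau>(1) d] by simp
  then have f: "ln r / q \<le> plus_norm \<tau>" using d by (subst (asm) mult_le_cancel_left_pos) auto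
  have "plus_norm \<tau> > 0" using q r(1) by (intro less_le_trans[OF _ f]) simp
  then have "q * plus_norm \<tau> < L 1 M \<tau>" using N[OF \<tau>(1)] \<tau>(2) by (simp add: field_simps)
  moreover have "ln r \<le> q * plus_norm \<tau>" using f q by (simp add: field_simps)
  moreover have "L 1 M \<tau> \<le> ln r"
    using r(2)[OF \<tau>(1)] L_le_ln[OF M] by blast
  ultimately show False by linarith
qed

section \<open>From the pointwise transference to the lower limits\<close>

theorem theorem6:
  fixes \<Lambda> :: "(real^'n) set"
  assumes "CARD('n) \<ge> 2"
    and "full_rank_lattice \<Lambda>"
    and "covolume \<Lambda> = 1"
  shows "psi_lower 1 \<Lambda> plus_norm
           \<le> psi_lower 1 (dual_lattice \<Lambda>) plus_norm / ereal ((real CARD('n) - 1)\<^sup>2)"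
proof (rule ccontr)
  \<comment> \<open>Here \<open>d\<close> is the dimension minus one.\<close>
  define d where "d = real CARD('n) - 1"
  have d: "d \<ge> 1" using assms(1) by (simp add: d_def)
  assume "\<not> ?thesis"
  then obtain q where q: "psi_lower 1 (dual_lattice \<Lambda>) plus_norm / ereal (d\<^sup>2) < ereal q"
      "ereal q < psi_lower 1 \<Lambda> plus_norm"
    using ereal_dense2 not_le unfolding d_def by metis
  \<comment> \<open>The gap \<open>p - q\<close> will absorb the constant \<open>C\<close>.\<close>
  then obtain p where p: "q < p" "ereal p < psi_lower 1 \<Lambda> plus_norm"
    using ereal_dense2 less_ereal.simps(1) by metis
  have "q < 0"
    using q(2) psi_lower_plus_norm_nonpos[OF assms(1,2)] by (metis less_ereal.simps(1) less_le_trans zero_ereal_def)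
  have less: "psi_lower 1 (dual_lattice \<Lambda>) plus_norm < ereal (d\<^sup>2 * q)"
    using q(1) d by (subst (asm) ereal_divide_less_iff) (auto simp: mult.commute)
  have frequent: "\<exists>\<tau>\<in>trace_zero. N \<le> infnorm \<tau> \<and>
      L 1 (dual_lattice \<Lambda>) \<tau> / plus_norm \<tau> < d\<^sup>2 * q" for N
  proof (rule ccontr)
    assume "\<not> ?thesis"
    then have "\<forall>\<tau>\<in>trace_zero. N \<le> infnorm \<tau> \<longrightarrow>
        ereal (d\<^sup>2 * q) \<le> ereal (L 1 (dual_lattice \<Lambda>) \<tau> / plus_norm \<tau>)"
      by (simp add: not_less)
    then have "ereal (d\<^sup>2 * q) \<le> psi_lower 1 (dual_lattice \<Lambda>) plus_norm"
      unfolding psi_lower_def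
      by (intro Liminf_bounded) (use eventually_infnorm_trace_zero_iff in blast)
    then show False using less by (simp add: not_less[symmetric])
  qed
  have "\<forall>\<^sub>F \<tau> in inf (filtercomap infnorm at_top) (principal trace_zero).
      ereal p < ereal (L 1 \<Lambda> \<tau> / plus_norm \<tau>)"
    using p(2) unfolding psi_lower_def by (rule less_LiminfD)
  then obtain N where N: "\<And>\<tau>. \<tau> \<in> trace_zero \<Longrightarrow> N \<le> infnorm \<tau> \<Longrightarrow> p < L 1 \<Lambda> \<tau> / plus_norm \<tau>"
    unfolding eventually_infnorm_trace_zero_iff by auto
  obtain K where K: "K > 0" "\<And>\<tau> v l R. \<tau> \<in> trace_zero \<Longrightarrow> v \<in> dual_lattice \<Lambda> \<Longrightarrow> v \<noteq> 0 \<Longrightarrow>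
      (\<And>i. \<bar>v $ i\<bar> \<le> l * exp (\<tau> $ i)) \<Longrightarrow> R > 0 \<Longrightarrow> K * l < R ^ (CARD('n) - 1) \<Longrightarrow>
      \<exists>x\<in>\<Lambda>. x \<noteq> 0 \<and> (\<forall>i. \<bar>x $ i\<bar> \<le> d * R * exp (- \<tau> $ i))"
    using dual_vector_transference[OF assms(1,2)] unfolding d_def by blast
  define C where "C = ln (d * (K + 1))"
  have "1 * (K + 1) \<le> d * (K + 1)"
    using d K(1) by (intro mult_right_mono) auto
  then have "1 < d * (K + 1)" using K(1) by (simp add: less_le_trans[of 1 "K + 1"])
  then have C: "C > 0" unfolding C_def by (rule ln_gt_zero)
  \<comment> \<open>The size condition makes \<open>C\<close> at most
    \<open>(p - q) * plus_norm\<close> at both \<tau> and \<open>- \<tau>\<close>, as these share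
    their \<open>infnorm\<close>.\<close>
  obtain \<tau> where \<tau>: "\<tau> \<in> trace_zero" "max N (d * (C / (p - q))) \<le> infnorm \<tau>"
      "L 1 (dual_lattice \<Lambda>) \<tau> / plus_norm \<tau> < d\<^sup>2 * q"
    using frequent by blast
  have \<tau>': "- \<tau> \<in> trace_zero" using \<tau>(1) by (simp add: trace_zero_def sum_negf)
  have large: "C / (p - q) \<le> plus_norm \<sigma>" if "\<sigma> \<in> trace_zero" "infnorm \<sigma> = infnorm \<tau>" for \<sigma> :: "real^'n"
  proof -
    have "d * (C / (p - q)) \<le> d * plus_norm \<sigma>"
      using \<tau>(2) infnorm_le_plus_norm[OF that(1) assms(1)] that(2) by (simp add: d_def)
    then show ?thesis using d by (subst (asm) mult_le_cancel_left_pos) auto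
  qed
  have "C / (p - q) > 0" using C p(1) by simp
  then have f: "plus_norm \<tau> > 0" "plus_norm (- \<tau>) > 0"
    using large[OF \<tau>(1)] large[OF \<tau>'] infnorm_neg[of \<tau>] by auto
  define b where "b = d\<^sup>2 * q * plus_norm \<tau>"
  have "L 1 (dual_lattice \<Lambda>) \<tau> < b"
    using \<tau>(3) f(1) by (simp add: b_def divide_less_eq)
  then obtain v where v: "v \<in> dual_lattice \<Lambda>" "v \<noteq> 0" "\<And>i. \<bar>v $ i\<bar> \<le> exp b * exp (\<tau> $ i)"
    using dual_lattice_nonzero[OF assms(2)] L_less_imp_short_vector by metis
  \<comment> \<open>Chosen so that \<open>R ^ (CARD('n) - 1)\<close> is a multiple of
    \<open>exp b\<close> with factor above \<open>K\<close>; the root turns \<open>b\<close> into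
    \<open>b / d\<close>, the first saving of \<open>d\<close>.\<close>
  define R where "R = (K + 1) * exp (b / d)"
  have "R ^ (CARD('n) - 1) = (K + 1) ^ (CARD('n) - 1) * exp b"
    using assms(1) d by (simp add: R_def power_mult_distrib exp_of_nat_mult[symmetric] d_def of_nat_diff)
  moreover have "K < (K + 1) ^ (CARD('n) - 1)"
    using power_increasing[of 1 "CARD('n) - 1" "K + 1"] assms(1) K(1) by (simp add: Suc_le_eq)
  ultimately have R: "R > 0" "K * exp b < R ^ (CARD('n) - 1)"
    using K(1) by (simp_all add: R_def)
  obtain x where x: "x \<in> \<Lambda>" "x \<noteq> 0" "\<And>i. \<bar>x $ i\<bar> \<le> d * R * exp (- \<tau> $ i)"
    using K(2)[OF \<tau>(1) v R] by blast
  have "L 1 \<Lambda> (- \<tau>) \<le> ln (d * R)"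
    using L_le_ln[OF assms(2) x(1,2)] x(3) by simp
  also have "\<dots> = C + b / d"
    using d K(1) by (simp add: R_def C_def ln_mult)
  also have "b / d = q * (d * plus_norm \<tau>)"
    using d by (simp add: b_def power2_eq_square)
  \<comment> \<open>The second factor \<open>d\<close> is used up here; the direction is right
    because \<open>q < 0\<close>.\<close>
  also have "\<dots> \<le> q * plus_norm (- \<tau>)"
    using plus_norm_uminus_le[OF \<tau>(1)] \<open>q < 0\<close> by (simp add: d_def)
  finally have "L 1 \<Lambda> (- \<tau>) \<le> C + q * plus_norm (- \<tau>)" by simp
  moreover have "p * plus_norm (- \<tau>) < L 1 \<Lambda> (- \<tau>)"
    using N[OF \<tau>'] \<tau>(2) f(2) by (simp add: infnorm_neg less_divide_eq)
  moreover have "C \<le> (p - q) * plus_norm (- \<tau>)"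
    using large[OF \<tau>'] p(1) by (simp add: infnorm_neg field_simps)
  ultimately show False by (simp add: algebra_simps)
qed

end
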